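(* Let $a_0,a_1,a_2,\ldots$ and $b_1,b_2,\ldots$ be sequences of integers with $b_n\ge 2$ and $0\le a_n\le b_n-1$ for all $n\ge 1$, and suppose that for every prime $p$ the set $\{n\ge 1 : p\mid b_n\}$ is infinite. Let $\sigma=(b_1,b_2,\ldots)$, and suppose that the Cantor series $$\theta = a_0+\frac{a_1}{b_1}+\frac{a_2}{b_1b_2}+\frac{a_3}{b_1b_2b_3}+\cdots$$ is an irrational number. Let $p\in\mathbb{Z}$ and $q\in\mathbb{Z}\setminus\{0\}$ be such that $D(q,\sigma)>1$, and let $k$ be the smallest integer greater than $D(q,\sigma)$ such that the interval $I_k$ lies in the interior of $I_{D(q,\sigma)}$. Then $$\left|\theta-\frac{p}{q}\right| > \frac{\min\{a_k,\; b_k-a_k-1\}}{b_1\cdots b_k}.$$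
   Context: Here $\mathbb{N}=\{1,2,3,\ldots\}$. For a nonzero integer $q$, $D(q,\sigma):=\min\{n\in\mathbb{N} : q\mid b_1b_2\cdots b_n\}$; this is well defined because every prime divides infinitely many of the $b_n$. For $n\ge 1$, $$I_n=\left[a_0+\frac{a_1}{b_1}+\cdots+\frac{a_n}{b_1\cdots b_n},\; a_0+\frac{a_1}{b_1}+\cdots+\frac{a_{n-1}}{b_1\cdots b_{n-1}}+\frac{a_n+1}{b_1\cdots b_n}\right]$$ is a closed interval of length $\frac{1}{b_1\cdots b_n}$. *)

theory Defs
  imports "HOL-Analysis.Analysis" "HOL-Computational_Algebra.Primes"
begin

text \<open>
  Both sequences are functions on \<^typ>\<open>nat\<close>; the sequence \<open>b\<close> starts at index 1, and the
  value \<open>b 0\<close> is never used.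
\<close>

definition cantor_prod :: "(nat \<Rightarrow> int) \<Rightarrow> nat \<Rightarrow> int" where
  "cantor_prod b n = (\<Prod>i = 1..n. b i)"

definition cantor_series :: "(nat \<Rightarrow> int) \<Rightarrow> (nat \<Rightarrow> int) \<Rightarrow> real" where
  "cantor_series a b = (\<Sum>n. real_of_int (a n) / real_of_int (cantor_prod b n))"

definition cantor_D :: "int \<Rightarrow> (nat \<Rightarrow> int) \<Rightarrow> nat" where
  "cantor_D q b = (LEAST n. n \<ge> 1 \<and> q dvd cantor_prod b n)"

definition cantor_interval :: "(nat \<Rightarrow> int) \<Rightarrow> (nat \<Rightarrow> int) \<Rightarrow> nat \<Rightarrow> real set" where
  "cantor_interval a b n =
    {(\<Sum>i = 0..n. real_of_int (a i) / real_of_int (cantor_prod b i)) ..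
     (\<Sum>i = 0..n - 1. real_of_int (a i) / real_of_int (cantor_prod b i))
        + real_of_int (a n + 1) / real_of_int (cantor_prod b n)}"

end

theory Submission
  imports Defs
begin

text \<open>
  Since \<open>q\<close> divides \<open>b\<^sub>1 \<cdots> b\<^sub>D\<close>, both \<open>p/q\<close> and the endpoints of \<open>I\<^sub>D\<close> are integer multiples of
  \<open>1/(b\<^sub>1 \<cdots> b\<^sub>D)\<close>, so \<open>p/q\<close> is not an interior point of \<open>I\<^sub>D\<close>, whereas \<open>\<theta>\<close>, being irrational, lies in
  the interior of every \<open>I\<^sub>n\<close>.  Hence \<open>p/q\<close> is at least as far from \<open>\<theta>\<close> as the nearer endpoint of
  \<open>I\<^sub>D\<close>.  The intervals are nested and \<open>I\<^sub>k\<close> keeps distances \<open>a\<^sub>k/(b\<^sub>1 \<cdots> b\<^sub>k)\<close> and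
  \<open>(b\<^sub>k - a\<^sub>k - 1)/(b\<^sub>1 \<cdots> b\<^sub>k)\<close> from the endpoints of \<open>I\<^bsub>k-1\<^esub>\<close>, which lies in \<open>I\<^sub>D\<close>
  because \<open>k > D\<close>.  The minimum defining \<open>k\<close> exists since the \<open>I\<^sub>j\<close> shrink to the interior point \<open>\<theta>\<close>.
\<close>

lemma cantor_prod_0 [simp]: "cantor_prod b 0 = 1"
  by (simp add: cantor_prod_def)

lemma cantor_prod_Suc [simp]: "cantor_prod b (Suc n) = cantor_prod b n * b (Suc n)"
  by (simp add: cantor_prod_def)

lemma cantor_prod_dvd: "m \<le> n \<Longrightarrow> cantor_prod b m dvd cantor_prod b n"
  unfolding cantor_prod_def by (intro prod_dvd_prod_subset) auto

text \<open>Induction on the prime factors of \<open>q\<close>: each prime \<open>r\<close>, even a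
  repeated one, is supplied by a fresh factor \<open>b j\<close> lying beyond the product already
  used. This makes the \<open>LEAST\<close> in \<open>cantor_D\<close> attained.\<close>

lemma ex_dvd_cantor_prod:
  fixes b :: "nat \<Rightarrow> int" and q :: int
  assumes inf: "\<And>r :: int. prime r \<Longrightarrow> infinite {n. n \<ge> 1 \<and> r dvd b n}"
    and "q \<noteq> 0"
  shows "\<exists>n\<ge>1. q dvd cantor_prod b n"
  using \<open>q \<noteq> 0\<close>
proof (induction q rule: prime_divisors_induct)
  case zero
  then show ?case by simp
next
  case (unit q)
  then show ?case by (meson le_refl unit_imp_dvd)
next
  case (factor r q)
  then obtain n where n: "n \<ge> 1" "q dvd cantor_prod b n" by auto
  obtain j where j: "j > n" "r dvd b j"
    using inf[OF factor.hyps] unfolding infinite_nat_iff_unbounded by blast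
  \<comment> \<open>Splitting off the last factor: \<open>q\<close> divides the product up to
    \<open>i\<close>, and \<open>r\<close> divides \<open>b (Suc i)\<close>.\<close>
  then obtain i where i: "j = Suc i" "n \<le> i" by (cases j) auto
  have "q dvd cantor_prod b i" using n(2) cantor_prod_dvd[OF i(2)] dvd_trans by blast
  then have "r * q dvd cantor_prod b j"
    using j(2) i(1) by (metis cantor_prod_Suc mult.commute mult_dvd_mono)
  then show ?case using j(1) by (intro exI[of _ j]) auto
qed

definition cantor_lower :: "(nat \<Rightarrow> int) \<Rightarrow> (nat \<Rightarrow> int) \<Rightarrow> nat \<Rightarrow> real" where
  "cantor_lower a b n = (\<Sum>i = 0..n. real_of_int (a i) / real_of_int (cantor_prod b i))"

text \<open>Writing the right endpoint as left endpoint plus length avoids the index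
  \<open>n - 1\<close> and gives a sensible value at \<open>n = 0\<close> too.\<close>

definition cantor_upper :: "(nat \<Rightarrow> int) \<Rightarrow> (nat \<Rightarrow> int) \<Rightarrow> nat \<Rightarrow> real" where
  "cantor_upper a b n = cantor_lower a b n + 1 / real_of_int (cantor_prod b n)"

lemma cantor_lower_Suc:
  "cantor_lower a b (Suc n) = cantor_lower a b n + real_of_int (a (Suc n)) / real_of_int (cantor_prod b (Suc n))"
  by (simp add: cantor_lower_def)

lemma cantor_interval_eq:
  assumes "n \<ge> 1"
  shows "cantor_interval a b n = {cantor_lower a b n .. cantor_upper a b n}"
  using assms by (cases n)
    (simp_all add: cantor_interval_def cantor_upper_def cantor_lower_def add_divide_distrib)

lemma cantor_lower_in_Rats: "cantor_lower a b n \<in> \<rat>"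
  unfolding cantor_lower_def by (intro Rats_sum Rats_divide) simp_all

lemma cantor_upper_in_Rats: "cantor_upper a b n \<in> \<rat>"
  by (auto simp: cantor_upper_def cantor_lower_in_Rats)

locale cantor_digits =
  fixes a b :: "nat \<Rightarrow> int"
  assumes base_ge_2: "n \<ge> 1 \<Longrightarrow> b n \<ge> 2"
    and digit_nonneg: "n \<ge> 1 \<Longrightarrow> 0 \<le> a n"
    and digit_less: "n \<ge> 1 \<Longrightarrow> a n \<le> b n - 1"
begin

lemma cantor_prod_ge: "cantor_prod b n \<ge> 2 ^ n"
proof (induction n)
  case (Suc n)
  have "2 ^ n * 2 \<le> cantor_prod b n * b (Suc n)"
    using Suc base_ge_2[of "Suc n"] order_trans[OF zero_le_power Suc]
    by (intro mult_mono) simp_all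
  then show ?case by simp
qed simp

lemma cantor_prod_pos: "cantor_prod b n > 0"
  using cantor_prod_ge[of n] zero_less_power[of "2::int" n] by linarith

text \<open>The level-\<open>n\<close> interval splits into \<open>b (Suc n)\<close> equal pieces;
  the next interval has \<open>a (Suc n)\<close> of them to its left, hence
  \<open>b (Suc n) - a (Suc n) - 1\<close> to its right.\<close>

lemma cantor_upper_Suc:
  "cantor_upper a b n = cantor_upper a b (Suc n)
     + real_of_int (b (Suc n) - a (Suc n) - 1) / real_of_int (cantor_prod b (Suc n))"
  using cantor_prod_pos[of n] base_ge_2[of "Suc n"]
  by (simp add: cantor_upper_def cantor_lower_Suc field_simps)

lemma cantor_lower_mono: "m \<le> n \<Longrightarrow> cantor_lower a b m \<le> cantor_lower a b n"
proof (rule lift_Suc_mono_le[of "cantor_lower a b"])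
  show "cantor_lower a b n \<le> cantor_lower a b (Suc n)" for n
    unfolding cantor_lower_Suc using cantor_prod_pos[of "Suc n"] digit_nonneg[of "Suc n"]
    by (simp del: cantor_prod_Suc)
qed

lemma cantor_upper_antimono: "m \<le> n \<Longrightarrow> cantor_upper a b n \<le> cantor_upper a b m"
proof (rule lift_Suc_antimono_le[of "cantor_upper a b"])
  show "cantor_upper a b (Suc n) \<le> cantor_upper a b n" for n
    unfolding cantor_upper_Suc[of n] using cantor_prod_pos[of "Suc n"] digit_less[of "Suc n"]
    by (simp del: cantor_prod_Suc)
qed

lemma cantor_lower_le_upper: "cantor_lower a b m \<le> cantor_upper a b n"
proof -
  have "cantor_lower a b m \<le> cantor_lower a b (max m n)" by (simp add: cantor_lower_mono)
  also have "\<dots> \<le> cantor_upper a b (max m n)"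
    using cantor_prod_pos[of "max m n"] by (simp add: cantor_upper_def)
  also have "\<dots> \<le> cantor_upper a b n" by (simp add: cantor_upper_antimono)
  finally show ?thesis .
qed

lemma cantor_lower_tendsto: "cantor_lower a b \<longlonglongrightarrow> cantor_series a b"
proof -
  have "incseq (cantor_lower a b)" by (simp add: incseq_def cantor_lower_mono)
  \<comment> \<open>Any fixed upper endpoint bounds all lower endpoints; index 0 is just a
    convenient choice. Convergence has to come first, since \<open>cantor_series\<close> is defined
    by an infinite sum.\<close>
  then obtain L where L: "cantor_lower a b \<longlonglongrightarrow> L"
    using incseq_convergent[of "cantor_lower a b" "cantor_upper a b 0"] cantor_lower_le_upper by blast
  then have "(\<lambda>n. real_of_int (a n) / real_of_int (cantor_prod b n)) sums L"
    unfolding sums_def_le cantor_lower_def[abs_def] by (simp add: atLeast0AtMost)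
  then show ?thesis using L by (simp add: cantor_series_def sums_iff)
qed

text \<open>The two endpoints differ by the interval length, which is at most
  \<open>(1/2) ^ n\<close> because every base is at least 2.\<close>

lemma cantor_upper_tendsto: "cantor_upper a b \<longlonglongrightarrow> cantor_series a b"
proof -
  have "(\<lambda>n. 1 / real_of_int (cantor_prod b n)) \<longlonglongrightarrow> 0"
  proof (rule tendsto_sandwich[of "\<lambda>_. 0" _ _ "\<lambda>n. (1/2) ^ n"])
    show "\<forall>\<^sub>F n in sequentially. 1 / real_of_int (cantor_prod b n) \<le> (1/2) ^ n"
    proof (intro always_eventually allI)
      fix n
      have "(2::real) ^ n \<le> real_of_int (cantor_prod b n)"
        using cantor_prod_ge[of n] by (metis of_int_le_iff of_int_numeral of_int_power)
      then show "1 / real_of_int (cantor_prod b n) \<le> (1/2) ^ n"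
        by (simp add: power_one_over frac_le)
    qed
  qed (use cantor_prod_pos in \<open>auto intro!: always_eventually LIMSEQ_realpow_zero simp: less_imp_le\<close>)
  from tendsto_add[OF cantor_lower_tendsto this] show ?thesis
    by (simp add: cantor_upper_def[abs_def])
qed

lemma cantor_lower_le_series: "cantor_lower a b n \<le> cantor_series a b"
  by (rule LIMSEQ_le_const[OF cantor_lower_tendsto]) (blast intro: cantor_lower_mono)

lemma cantor_series_le_upper: "cantor_series a b \<le> cantor_upper a b n"
  by (rule LIMSEQ_le_const2[OF cantor_lower_tendsto]) (simp add: cantor_lower_le_upper)

text \<open>Equality is excluded because the endpoint is a finite sum of rationals.\<close>

lemma cantor_lower_less_series:
  assumes "cantor_series a b \<notin> \<rat>"
  shows "cantor_lower a b n < cantor_series a b"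
  using cantor_lower_le_series[of n] cantor_lower_in_Rats[of a b n] assms by (metis order_le_less)

lemma cantor_series_less_upper:
  assumes "cantor_series a b \<notin> \<rat>"
  shows "cantor_series a b < cantor_upper a b n"
  using cantor_series_le_upper[of n] cantor_upper_in_Rats[of a b n] assms by (metis order_le_less)

lemma ex_interval_subset_interior:
  assumes "cantor_series a b \<notin> \<rat>" and "n \<ge> 1"
  shows "\<exists>j>n. cantor_interval a b j \<subseteq> interior (cantor_interval a b n)"
proof -
  have "\<forall>\<^sub>F j in sequentially. cantor_lower a b n < cantor_lower a b j"
    by (rule order_tendstoD(1)[OF cantor_lower_tendsto cantor_lower_less_series[OF assms(1)]])
  moreover have "\<forall>\<^sub>F j in sequentially. cantor_upper a b j < cantor_upper a b n"
    by (rule order_tendstoD(2)[OF cantor_upper_tendsto cantor_series_less_upper[OF assms(1)]])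
  ultimately have "\<forall>\<^sub>F j in sequentially. j > n \<and> cantor_lower a b n < cantor_lower a b j
      \<and> cantor_upper a b j < cantor_upper a b n"
    using eventually_gt_at_top[of n] by eventually_elim simp
  then obtain j where "j > n" "cantor_lower a b n < cantor_lower a b j"
      "cantor_upper a b j < cantor_upper a b n"
    using eventually_happens by fastforce
  then show ?thesis using assms(2)
    by (intro exI[of _ j]) (auto simp: cantor_interval_eq interior_atLeastAtMost_real)
qed

text \<open>The scaled partial sums obey the Horner recursion
  \<open>x (Suc n) = b (Suc n) * x n + a (Suc n)\<close>, starting from \<open>a 0\<close>.\<close>

lemma cantor_prod_times_lower_in_Ints: "real_of_int (cantor_prod b n) * cantor_lower a b n \<in> \<int>"
proof (induction n)
  case 0
  then show ?case by (simp add: cantor_lower_def)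
next
  case (Suc n)
  have "real_of_int (cantor_prod b (Suc n)) * cantor_lower a b (Suc n)
     = of_int (b (Suc n)) * (of_int (cantor_prod b n) * cantor_lower a b n) + of_int (a (Suc n))"
    using cantor_prod_pos[of n] base_ge_2[of "Suc n"] by (simp add: cantor_lower_Suc distrib_left mult_ac)
  with Suc show ?case by simp
qed

lemma rational_not_in_interior:
  assumes "q \<noteq> 0" and "q dvd cantor_prod b n"
  shows "real_of_int p / real_of_int q \<le> cantor_lower a b n
       \<or> cantor_upper a b n \<le> real_of_int p / real_of_int q"
proof -
  define P where "P = cantor_prod b n"
  have P: "P > 0" unfolding P_def by (rule cantor_prod_pos)
  obtain t where t: "P = q * t" using assms(2) unfolding P_def by (elim dvdE)
  obtain c where c: "real_of_int P * cantor_lower a b n = of_int c"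
    using cantor_prod_times_lower_in_Ints[of n] unfolding P_def by (elim Ints_cases)
  have low: "cantor_lower a b n = of_int c / of_int P" using c P by (simp add: field_simps)
  have up: "cantor_upper a b n = of_int (c + 1) / of_int P"
    by (simp add: cantor_upper_def low add_divide_distrib flip: P_def)
  have pq: "real_of_int p / real_of_int q = of_int (p * t) / of_int P"
    using t P assms(1) by auto
  \<comment> \<open>Over the common denominator \<open>P\<close> the endpoints have consecutive
    numerators, and no integer lies strictly between \<open>c\<close> and
    \<open>c + 1\<close>.\<close>
  have "p * t \<le> c \<or> c + 1 \<le> p * t" by linarith
  then show ?thesis unfolding low up pq using P
    by (metis divide_right_mono less_imp_le of_int_0_le_iff of_int_le_iff)
qed

lemma cantor_series_approx:
  assumes irr: "cantor_series a b \<notin> \<rat>" and "q \<noteq> 0" and "q dvd cantor_prod b n" and "n < k"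
  shows "real_of_int (min (a k) (b k - a k - 1)) / real_of_int (cantor_prod b k)
       < \<bar>cantor_series a b - real_of_int p / real_of_int q\<bar>"
proof -
  obtain i where k: "k = Suc i" and i: "n \<le> i" using \<open>n < k\<close> by (cases k) auto
  let ?P = "real_of_int (cantor_prod b k)"
  have P: "?P > 0" using cantor_prod_pos[of k] by simp
  \<comment> \<open>With \<open>k = Suc i\<close>, the lower endpoint at \<open>k\<close> is the one
    at \<open>i\<close> plus \<open>a k / ?P\<close>, and the one at \<open>i\<close> is at least
    the one at \<open>n\<close>. Strictness comes from the irrationality of the series.\<close>
  have "cantor_lower a b n + of_int (a k) / ?P < cantor_series a b"
    using cantor_lower_mono[OF i] cantor_lower_Suc[of a b i] cantor_lower_less_series[OF irr, of k]
    unfolding k by linarith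
  moreover have "cantor_series a b + of_int (b k - a k - 1) / ?P < cantor_upper a b n"
    using cantor_upper_antimono[OF i] cantor_upper_Suc[of i] cantor_series_less_upper[OF irr, of k]
    unfolding k by linarith
  moreover have "of_int (min (a k) (b k - a k - 1)) / ?P \<le> of_int (a k) / ?P"
    using P by (intro divide_right_mono) simp_all
  moreover have "of_int (min (a k) (b k - a k - 1)) / ?P \<le> of_int (b k - a k - 1) / ?P"
    using P by (intro divide_right_mono) (simp_all only: of_int_le_iff min.cobounded2 less_imp_le)
  ultimately show ?thesis using rational_not_in_interior[OF assms(2,3), of p] by linarith
qed

end

theorem mainTheorem1:
  fixes a b :: "nat \<Rightarrow> int" and \<theta> :: real and p q :: int and k :: nat
  assumes "\<And>n. n \<ge> 1 \<Longrightarrow> b n \<ge> 2"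
    and "\<And>n. n \<ge> 1 \<Longrightarrow> 0 \<le> a n \<and> a n \<le> b n - 1"
    and "\<And>r :: int. prime r \<Longrightarrow> infinite {n. n \<ge> 1 \<and> r dvd b n}"
    and "\<theta> = cantor_series a b"
    and "\<theta> \<notin> \<rat>"
    and "q \<noteq> 0"
    and "cantor_D q b > 1"
    and "k = (LEAST j. j > cantor_D q b \<and>
            cantor_interval a b j \<subseteq> interior (cantor_interval a b (cantor_D q b)))"
  shows "\<bar>\<theta> - real_of_int p / real_of_int q\<bar>
           > real_of_int (min (a k) (b k - a k - 1)) / real_of_int (cantor_prod b k)"
proof -
  interpret cantor_digits a b
    by unfold_locales (use assms(1,2) in auto)
  have irr: "cantor_series a b \<notin> \<rat>" using assms(4,5) by simp
  have D: "cantor_D q b \<ge> 1 \<and> q dvd cantor_prod b (cantor_D q b)"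
    unfolding cantor_D_def using ex_dvd_cantor_prod[OF assms(3,6)] by (rule LeastI_ex)
  \<comment> \<open>The defining property of a \<open>LEAST\<close> is available only once some
    \<open>j\<close> is known to satisfy it, here by the shrinking of the intervals.\<close>
  have "k > cantor_D q b"
    unfolding assms(8)
    using LeastI_ex[OF ex_interval_subset_interior[OF irr conjunct1[OF D]]] by (rule conjunct1)
  with D show ?thesis
    unfolding assms(4) using cantor_series_approx[OF irr assms(6)] by blast
qed

end
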